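(* Let $n\ge1$, let $\lambda=(\lambda_1\ge\cdots\ge\lambda_n\ge0)$ be a partition (padded with zeros to length $n$), and set $A_{ij}=\lambda_i-\lambda_j+j-i$ for $1\le i<j\le n$. Then $$\sum_{k_1,\dots,k_n\ge0}\Big(\prod_{1\le i<j\le n}\frac{A_{ij}+k_i-k_j}{A_{ij}}\Big)\prod_{i=1}^n\frac{(-(i-1))_{k_i}}{(1)_{k_i}}=\frac{1}{|\mathrm{SST}(\lambda,n)|}=\prod_{1\le i<j\le n}\frac{j-i}{\lambda_i-\lambda_j+j-i},$$ i.e. $F^{(n)}\big((A_{ij})\,|\,(0,-1,\dots,-(n-1))^T\,|\,(1,\dots,1)^T\,|\,(1,\dots,1)^T\big)=1/|\mathrm{SST}(\lambda,n)|$.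
   Context: $(a)_0=1$, $(a)_m=a(a+1)\cdots(a+m-1)$; the sum is finite since $(-(i-1))_{k_i}=0$ for $k_i>i-1$. Holman's function $F^{(n)}\big((A_{ij})\,|\,(a_{i})\,|\,(b_{i})\,|\,(z_i)\big)=\sum_{k_1,\dots,k_n\ge0}\prod_{i<j}\frac{A_{ij}+k_i-k_j}{A_{ij}}\prod_{i}\frac{(a_i)_{k_i}}{(b_i)_{k_i}}z_i^{k_i}$. $\mathrm{SST}(\lambda,n)$ is the set of semistandard tableaux of shape $\lambda$ with entries in $\{1,\dots,n\}$ (rows weakly increasing, columns strictly increasing), whose cardinality is $\prod_{1\le i<j\le n}\frac{\lambda_i-\lambda_j+j-i}{j-i}$. *)

theory Defs
  imports "HOL-Analysis.Analysis"
begin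

definition yd_cells :: "(nat \<Rightarrow> nat) \<Rightarrow> nat \<Rightarrow> (nat \<times> nat) set" where
  "yd_cells lam n = {(r, c). 1 \<le> r \<and> r \<le> n \<and> 1 \<le> c \<and> c \<le> lam r}"

definition SST :: "(nat \<Rightarrow> nat) \<Rightarrow> nat \<Rightarrow> (nat \<times> nat \<Rightarrow> nat) set" where
  "SST lam n = {T.
     (\<forall>x. x \<notin> yd_cells lam n \<longrightarrow> T x = 0) \<and>
     (\<forall>x\<in>yd_cells lam n. T x \<in> {1..n}) \<and>
     (\<forall>r c. (r, c) \<in> yd_cells lam n \<and> (r, c + 1) \<in> yd_cells lam n \<longrightarrow> T (r, c) \<le> T (r, c + 1)) \<and>
     (\<forall>r c. (r, c) \<in> yd_cells lam n \<and> (r + 1, c) \<in> yd_cells lam n \<longrightarrow> T (r, c) < T (r + 1, c))}"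

definition Aij :: "(nat \<Rightarrow> nat) \<Rightarrow> nat \<Rightarrow> nat \<Rightarrow> real" where
  "Aij lam i j = real (lam i) - real (lam j) + real j - real i"

text \<open>Summand of Holman's series with a_i = -(i-1), b_i = 1, z_i = 1.\<close>
definition holman_term :: "(nat \<Rightarrow> nat) \<Rightarrow> nat \<Rightarrow> (nat \<Rightarrow> nat) \<Rightarrow> real" where
  "holman_term lam n k =
     (\<Prod>(i, j)\<in>{(i, j). 1 \<le> i \<and> i < j \<and> j \<le> n}.
        (Aij lam i j + real (k i) - real (k j)) / Aij lam i j) *
     (\<Prod>i\<in>{1..n}. pochhammer (- real (i - 1)) (k i) / pochhammer 1 (k i))"

end

theory Submission
  imports Defs "HOL-Probability.Product_PMF" "Jordan_Normal_Form.Determinant"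
begin

text \<open>
  With \<open>x\<^sub>i = i - \<lambda>\<^sub>i\<close> we have \<open>A\<^sub>i\<^sub>j = x\<^sub>j - x\<^sub>i\<close>. In the basis of binomial polynomials the Vandermonde
  product becomes \<open>D\<^sub>n(x) = det (x\<^sub>i choose (j - 1)) = \<Prod>\<^sub>i\<^sub><\<^sub>j (x\<^sub>j - x\<^sub>i) / (j - i)\<close>. Both halves follow
  from the row multilinearity of this determinant. The Holman weights are \<open>(-1)\<^sup>k (i - 1 choose k)\<close>, so
  summing over \<open>k\<^sub>i\<close> takes the backward difference of order \<open>i - 1\<close> of row \<open>i\<close>; the result is upper
  unitriangular and the weighted sum of \<open>D\<^sub>n(x - k)\<close> equals 1. Removing the entries \<open>n + 1\<close> from a
  tableau gives a sum over interlacing shapes, which on the determinant side telescopes to the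
  differences of consecutive rows, so \<open>D\<^sub>n(x)\<close> counts the tableaux.
\<close>

section \<open>Determinants of doubly indexed families\<close>

definition square_det :: "nat \<Rightarrow> (nat \<Rightarrow> nat \<Rightarrow> 'a :: comm_ring_1) \<Rightarrow> 'a" where
  "square_det n f = Determinant.det (Matrix.mat n n (\<lambda>(i, j). f (Suc i) (Suc j)))"

lemma square_det_0 [simp]: "square_det 0 f = 1"
  by (simp add: square_det_def)

lemma square_det_cong:
  assumes "\<And>i j. i \<in> {1..n} \<Longrightarrow> j \<in> {1..n} \<Longrightarrow> f i j = g i j"
  shows "square_det n f = square_det n g"
  unfolding square_det_def
  by (intro arg_cong[of _ _ Determinant.det] eq_matI) (auto simp: assms)

lemma square_det_Leibniz:
  "square_det n f
     = (\<Sum>p | p permutes {0..<n}. signof p * (\<Prod>i = 1..n. f i (Suc (p (i - 1)))))"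
proof -
  have "(\<Prod>i = 0..<n. Matrix.mat n n (\<lambda>(i, j). f (Suc i) (Suc j)) $$ (i, p i))
      = (\<Prod>i = 1..n. f i (Suc (p (i - 1))))" if "p permutes {0..<n}" for p
  proof -
    have "p i < n" if "i < n" for i
      using permutes_in_image[OF \<open>p permutes {0..<n}\<close>, of i] that by simp
    then show ?thesis
      by (intro prod.reindex_bij_witness[of _ "\<lambda>i. i - 1" Suc]) auto
  qed
  then show ?thesis
    unfolding square_det_def by (subst det_def'[of _ n]) (auto intro!: sum.cong)
qed

lemma square_det_transpose: "square_det n (\<lambda>i j. f j i) = square_det n f"
proof -
  let ?A = "Matrix.mat n n (\<lambda>(i, j). f (Suc i) (Suc j))"
  have "transpose_mat ?A = Matrix.mat n n (\<lambda>(i, j). f (Suc j) (Suc i))"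
    by (rule eq_matI) auto
  then show ?thesis
    using det_transpose[of ?A n] by (simp add: square_det_def)
qed

lemma square_det_scale_rows:
  "square_det n (\<lambda>i j. c i * f i j) = (\<Prod>i = 1..n. c i) * square_det n f"
  by (simp add: square_det_Leibniz prod.distrib sum_distrib_left mult_ac)

lemma square_det_scale_columns:
  "square_det n (\<lambda>i j. c j * f i j) = (\<Prod>j = 1..n. c j) * square_det n f"
proof -
  have "square_det n (\<lambda>i j. c j * f i j) = square_det n (\<lambda>i j. c i * f j i)"
    by (rule square_det_transpose)
  also have "\<dots> = (\<Prod>j = 1..n. c j) * square_det n (\<lambda>i j. f j i)"
    by (rule square_det_scale_rows)
  finally show ?thesis
    unfolding square_det_transpose[of n f] .
qed

lemma sum_prod_PiE_dflt:
  fixes f :: "'a \<Rightarrow> 'b \<Rightarrow> 'c :: comm_semiring_1"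
  assumes "finite I" "\<And>i. i \<in> I \<Longrightarrow> finite (K i)"
  shows "(\<Sum>k\<in>PiE_dflt I d K. \<Prod>i\<in>I. f i (k i)) = (\<Prod>i\<in>I. \<Sum>k\<in>K i. f i k)"
proof -
  have "inj_on (\<lambda>k. restrict k I) (PiE_dflt I d K)"
    by (force simp: inj_on_def restrict_def fun_eq_iff PiE_dflt_def)
  then have "(\<Sum>k\<in>PiE I K. \<Prod>i\<in>I. f i (k i)) = (\<Sum>k\<in>PiE_dflt I d K. \<Prod>i\<in>I. f i (k i))"
    by (simp add: sum.reindex flip: restrict_PiE_dflt[of I d K])
  then show ?thesis
    using assms by (simp add: prod_sum_PiE)
qed

lemma square_det_sum_rows:
  assumes "\<And>i. i \<in> {1..n} \<Longrightarrow> finite (K i)"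
  shows "square_det n (\<lambda>i j. \<Sum>k\<in>K i. f i k j)
       = (\<Sum>k\<in>PiE_dflt {1..n} d K. square_det n (\<lambda>i. f i (k i)))"
proof -
  have "square_det n (\<lambda>i j. \<Sum>k\<in>K i. f i k j)
      = (\<Sum>p | p permutes {0..<n}. signof p *
          (\<Sum>k\<in>PiE_dflt {1..n} d K. \<Prod>i = 1..n. f i (k i) (Suc (p (i - 1)))))"
    unfolding square_det_Leibniz using assms by (subst sum_prod_PiE_dflt) auto
  then show ?thesis
    unfolding square_det_Leibniz by (subst sum.swap) (simp add: sum_distrib_left)
qed

lemma square_det_upper_triangular:
  assumes "\<And>i j. i \<in> {1..n} \<Longrightarrow> j \<in> {1..n} \<Longrightarrow> j < i \<Longrightarrow> f i j = 0"
  shows "square_det n f = (\<Prod>i = 1..n. f i i)"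
proof -
  let ?A = "Matrix.mat n n (\<lambda>(i, j). f (Suc i) (Suc j))"
  have "square_det n f = prod_list (diag_mat ?A)"
    unfolding square_det_def by (rule det_upper_triangular[of _ n]) (use assms in auto)
  also have "\<dots> = (\<Prod>i = 0..<n. f (Suc i) (Suc i))"
    by (simp add: prod_list_diag_prod)
  also have "\<dots> = (\<Prod>i = 1..n. f i i)"
    by (rule prod.reindex_bij_witness[of _ "\<lambda>i. i - 1" Suc]) auto
  finally show ?thesis .
qed

lemma square_det_Suc_unit_row:
  assumes "f 1 1 = 1" "\<And>j. j \<in> {1..n} \<Longrightarrow> f 1 (Suc j) = 0"
  shows "square_det (Suc n) f = square_det n (\<lambda>i j. f (Suc i) (Suc j))"
proof -
  let ?A = "Matrix.mat (Suc n) (Suc n) (\<lambda>(i, j). f (Suc i) (Suc j))"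
  have "square_det (Suc n) f = (\<Sum>j<Suc n. ?A $$ (0, j) * cofactor ?A 0 j)"
    unfolding square_det_def by (rule laplace_expansion_row) auto
  also have "\<dots> = cofactor ?A 0 0"
    using assms by (simp add: sum.lessThan_Suc_shift del: sum.lessThan_Suc)
  also have "mat_delete ?A 0 0 = Matrix.mat n n (\<lambda>(i, j). f (Suc (Suc i)) (Suc (Suc j)))"
    by (rule eq_matI) (auto simp: mat_delete_def)
  then have "cofactor ?A 0 0 = square_det n (\<lambda>i j. f (Suc i) (Suc j))"
    by (simp add: cofactor_def square_det_def)
  finally show ?thesis .
qed

lemma square_det_add_previous_column:
  "square_det n (\<lambda>i j. f i j + (if j = 1 then 0 else c j * f i (j - 1))) = square_det n f"
proof -
  define A where "A = Matrix.mat n n (\<lambda>(i, j). f (Suc i) (Suc j))"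
  define U where "U = Matrix.mat n n (\<lambda>(k, j).
    if k = j then 1 else if Suc k = j then c (Suc j) else 0)"
  have carrier: "A \<in> carrier_mat n n" "U \<in> carrier_mat n n"
    by (simp_all add: A_def U_def)
  have "Determinant.det U = prod_list (diag_mat U)"
    by (rule det_upper_triangular[OF _ carrier(2)]) (auto simp: U_def)
  then have det_U: "Determinant.det U = 1"
    by (simp add: prod_list_diag_prod U_def)
  have entry: "(A * U) $$ (i, j)
      = f (Suc i) (Suc j) + (if j = 0 then 0 else c (Suc j) * f (Suc i) j)"
    if "i < n" "j < n" for i j
  proof -
    have "(A * U) $$ (i, j) = (\<Sum>k<n. (if k = j then f (Suc i) (Suc k) else 0)
        + (if Suc k = j then c (Suc j) * f (Suc i) (Suc k) else 0))"
      using that by (auto simp: A_def U_def scalar_prod_def lessThan_atLeast0 intro!: sum.cong)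
    then show ?thesis
      using that by (cases j) (simp_all add: sum.distrib)
  qed
  have "A * U = Matrix.mat n n (\<lambda>(i, j).
      f (Suc i) (Suc j) + (if Suc j = 1 then 0 else c (Suc j) * f (Suc i) (Suc j - 1)))"
    by (rule eq_matI) (use carrier entry in auto)
  then show ?thesis
    using det_mult[OF carrier] det_U by (simp add: square_det_def A_def)
qed

lemma square_det_add_previous_row:
  "square_det n (\<lambda>i j. f i j + (if i = 1 then 0 else c i * f (i - 1) j)) = square_det n f"
proof -
  have "square_det n (\<lambda>i j. f i j + (if i = 1 then 0 else c i * f (i - 1) j))
      = square_det n (\<lambda>i j. f j i + (if j = 1 then 0 else c j * f (j - 1) i))"
    by (rule square_det_transpose)
  also have "\<dots> = square_det n (\<lambda>i j. f j i)"
    by (rule square_det_add_previous_column)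
  also have "\<dots> = square_det n f"
    by (rule square_det_transpose)
  finally show ?thesis .
qed

lemma square_det_Suc_row_differences:
  assumes "\<And>i. i \<in> {1..Suc n} \<Longrightarrow> f i 1 = 1"
  shows "square_det (Suc n) f = square_det n (\<lambda>i j. f (Suc i) (Suc j) - f i (Suc j))"
proof -
  define g where "g = (\<lambda>i j. f i j + (if i = 1 then 0 else - 1 * f (i - 1) j))"
  have "square_det (Suc n) f = square_det (Suc n) g"
    unfolding g_def by (rule square_det_add_previous_row[symmetric])
  also have "\<dots> = square_det (Suc n) (\<lambda>i j. g j i)"
    by (rule square_det_transpose[symmetric])
  also have "\<dots> = square_det n (\<lambda>i j. g (Suc j) (Suc i))"
    using assms by (intro square_det_Suc_unit_row) (auto simp: g_def)
  also have "\<dots> = square_det n (\<lambda>i j. g (Suc i) (Suc j))"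
    by (rule square_det_transpose)
  also have "\<dots> = square_det n (\<lambda>i j. f (Suc i) (Suc j) - f i (Suc j))"
    by (rule square_det_cong) (auto simp: g_def)
  finally show ?thesis .
qed

section \<open>Backward differences of binomial polynomials\<close>

definition backward_difference :: "('a :: ring_1 \<Rightarrow> 'b :: ab_group_add) \<Rightarrow> 'a \<Rightarrow> 'b" where
  "backward_difference f x = f x - f (x - 1)"

lemma sum_choose_Suc:
  fixes g :: "nat \<Rightarrow> 'a :: semiring_1"
  shows "(\<Sum>k\<le>Suc m. of_nat (Suc m choose k) * g k)
       = (\<Sum>k\<le>m. of_nat (m choose k) * (g k + g (Suc k)))"
proof -
  have "(\<Sum>k\<le>Suc m. of_nat (Suc m choose k) * g k)
      = (g 0 + (\<Sum>k\<le>m. of_nat (m choose Suc k) * g (Suc k)))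
        + (\<Sum>k\<le>m. of_nat (m choose k) * g (Suc k))"
    by (simp add: sum.atMost_Suc_shift sum.distrib algebra_simps del: sum.atMost_Suc)
  also have "g 0 + (\<Sum>k\<le>m. of_nat (m choose Suc k) * g (Suc k))
      = (\<Sum>k\<le>Suc m. of_nat (m choose k) * g k)"
    by (simp add: sum.atMost_Suc_shift del: sum.atMost_Suc)
  also have "\<dots> = (\<Sum>k\<le>m. of_nat (m choose k) * g k)"
    by (simp add: binomial_eq_0)
  finally show ?thesis
    by (simp add: sum.distrib distrib_left del: sum.atMost_Suc)
qed

lemma funpow_backward_difference:
  fixes f :: "'a :: ring_1 \<Rightarrow> 'b :: ring_1"
  shows "(backward_difference ^^ m) f x
     = (\<Sum>k\<le>m. of_nat (m choose k) * ((- 1) ^ k * f (x - of_nat k)))"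
proof (induction m arbitrary: x)
  case 0
  show ?case by simp
next
  case (Suc m)
  have "(backward_difference ^^ Suc m) f x
      = (backward_difference ^^ m) f x - (backward_difference ^^ m) f (x - 1)"
    unfolding funpow.simps comp_apply by (rule backward_difference_def)
  then show ?case
    unfolding Suc.IH sum_choose_Suc by (simp add: algebra_simps flip: sum_subtractf)
qed

lemma backward_difference_gbinomial_Suc:
  fixes x :: "'a :: field_char_0"
  shows "backward_difference (\<lambda>x. x gchoose Suc j) x = (x - 1) gchoose j"
  using gbinomial_Suc_Suc[of "x - 1" j] by (simp add: backward_difference_def)

lemma funpow_backward_difference_gbinomial:
  fixes x :: "'a :: field_char_0"
  shows "(backward_difference ^^ m) (\<lambda>x. x gchoose j) x
       = (if j < m then 0 else (x - of_nat m) gchoose (j - m))"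
proof (induction m arbitrary: x)
  case 0
  show ?case by simp
next
  case (Suc m)
  let ?g = "\<lambda>x :: 'a. if j < m then 0 else (x - of_nat m) gchoose (j - m)"
  have "(backward_difference ^^ m) (\<lambda>x. x gchoose j) = ?g"
    by (intro ext Suc.IH)
  then have "(backward_difference ^^ Suc m) (\<lambda>x. x gchoose j) x = backward_difference ?g x"
    by (simp only: funpow.simps comp_apply)
  also have "\<dots> = (if j < Suc m then 0 else (x - of_nat (Suc m)) gchoose (j - Suc m))"
  proof (cases "j \<le> m")
    case True
    then show ?thesis by (auto simp: backward_difference_def)
  next
    case False
    then have "j - m = Suc (j - Suc m)" by simp
    then show ?thesis
      using False backward_difference_gbinomial_Suc[of "j - Suc m" "x - of_nat m"]
      by (simp add: backward_difference_def algebra_simps)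
  qed
  finally show ?case .
qed

lemma sum_gbinomial_interval:
  fixes x :: "'a :: field_char_0"
  assumes "p \<le> q"
  shows "(\<Sum>m = p..q. (x - of_nat m) gchoose j)
       = ((x + 1 - of_nat p) gchoose Suc j) - ((x - of_nat q) gchoose Suc j)"
proof -
  define h where "h = (\<lambda>m. - ((x + 1 - of_nat m) gchoose Suc j))"
  have "(x - of_nat m) gchoose j = h (Suc m) - h m" for m
    using backward_difference_gbinomial_Suc[of j "x + 1 - of_nat m"]
    by (simp add: backward_difference_def h_def algebra_simps)
  then have "(\<Sum>m = p..q. (x - of_nat m) gchoose j) = (\<Sum>m = p..q. h (Suc m) - h m)"
    by simp
  also have "\<dots> = h (Suc q) - h p"
    using assms by (intro sum_Suc_diff) simp
  finally show ?thesis
    by (simp add: h_def)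
qed

section \<open>The binomial Vandermonde determinant\<close>

definition binomial_det :: "nat \<Rightarrow> (nat \<Rightarrow> 'a :: field_char_0) \<Rightarrow> 'a" where
  "binomial_det n x = square_det n (\<lambda>i j. x i gchoose (j - 1))"

lemma gbinomial_Suc_diff_gbinomial:
  fixes x y :: "'a :: field_char_0"
  shows "(x gchoose Suc m) - (y - of_nat m) / of_nat (Suc m) * (x gchoose m)
       = (x - y) / of_nat (Suc m) * (x gchoose m)"
proof -
  have "of_nat (Suc m) * (x gchoose Suc m) = (x - of_nat m) * (x gchoose m)"
    using gbinomial_absorb_comp[of x m] gbinomial_absorption[of m x] by simp
  then have "x gchoose Suc m = (x - of_nat m) / of_nat (Suc m) * (x gchoose m)"
    by (simp add: field_simps del: of_nat_Suc)
  then show ?thesis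
    by (simp add: diff_divide_distrib algebra_simps del: of_nat_Suc)
qed

lemma binomial_det_Suc:
  "binomial_det (Suc n) x
     = (\<Prod>j = 1..n. (x (Suc j) - x 1) / of_nat j) * binomial_det n (\<lambda>i. x (Suc i))"
proof -
  define f where "f = (\<lambda>i j. x i gchoose (j - 1))"
  \<comment> \<open>These column operations clear the first row beyond its leading entry 1.\<close>
  define g where "g = (\<lambda>i j. f i j
    + (if j = 1 then 0 else - ((x 1 - of_nat (j - 2)) / of_nat (j - 1)) * f i (j - 1)))"
  have column: "g i (Suc j) = (x i - x 1) / of_nat j * (x i gchoose (j - 1))" if "j \<ge> 1" for i j
    using gbinomial_Suc_diff_gbinomial[of "x i" "j - 1" "x 1"] that
    by (cases j) (simp_all add: f_def g_def)
  have "binomial_det (Suc n) x = square_det (Suc n) g"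
    unfolding binomial_det_def g_def f_def by (rule square_det_add_previous_column[symmetric])
  also have "\<dots> = square_det n (\<lambda>i j. g (Suc i) (Suc j))"
  proof (rule square_det_Suc_unit_row)
    show "g 1 1 = 1" by (simp add: f_def g_def)
  qed (simp add: column)
  also have "\<dots> = square_det n
      (\<lambda>i j. (x (Suc i) - x 1) * (1 / of_nat j * (x (Suc i) gchoose (j - 1))))"
    by (rule square_det_cong) (simp add: column)
  also have "\<dots> = (\<Prod>i = 1..n. x (Suc i) - x 1) * ((\<Prod>j = 1..n. 1 / of_nat j)
      * binomial_det n (\<lambda>i. x (Suc i)))"
    by (simp only: square_det_scale_rows square_det_scale_columns binomial_det_def)
  finally show ?thesis
    by (simp add: prod_dividef)
qed

lemma prod_strict_pairs:
  fixes f :: "nat \<Rightarrow> nat \<Rightarrow> 'a :: comm_monoid_mult"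
  shows "(\<Prod>(i, j)\<in>{(i, j). 1 \<le> i \<and> i < j \<and> j \<le> n}. f i j) = (\<Prod>i = 1..n. \<Prod>j = Suc i..n. f i j)"
proof -
  have "{(i, j). 1 \<le> i \<and> i < j \<and> j \<le> n} = (SIGMA i:{1..n}. {Suc i..n})"
    by auto
  then show ?thesis
    by (simp add: prod.Sigma)
qed

lemma binomial_det_eq_prod:
  "binomial_det n x
     = (\<Prod>(i, j)\<in>{(i, j). 1 \<le> i \<and> i < j \<and> j \<le> n}. (x j - x i) / of_nat (j - i))"
  unfolding prod_strict_pairs
proof (induction n arbitrary: x)
  case 0
  show ?case by (simp add: binomial_det_def)
next
  case (Suc n)
  show ?case
    unfolding binomial_det_Suc Suc.IH
    by (subst prod.atLeast_Suc_atMost)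
       (simp_all add: prod.shift_bounds_cl_Suc_ivl del: prod.cl_ivl_Suc of_nat_diff)
qed

lemma sum_alternating_binomial_det:
  "(\<Sum>k\<in>PiE_dflt {1..n} 0 (\<lambda>i. {..i - 1}).
      (\<Prod>i = 1..n. (- 1) ^ k i * of_nat ((i - 1) choose k i))
        * binomial_det n (\<lambda>i. x i - of_nat (k i))) = 1"
proof -
  define a where "a = (\<lambda>i k j.
    ((- 1) ^ k * of_nat ((i - 1) choose k)) * ((x i - of_nat k) gchoose (j - 1)))"
  have weighted: "(\<Prod>i = 1..n. (- 1) ^ k i * of_nat ((i - 1) choose k i))
        * binomial_det n (\<lambda>i. x i - of_nat (k i))
      = square_det n (\<lambda>i. a i (k i))" for k
    unfolding a_def binomial_det_def by (rule square_det_scale_rows[symmetric])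
  have "(\<Sum>k\<in>PiE_dflt {1..n} 0 (\<lambda>i. {..i - 1}).
      (\<Prod>i = 1..n. (- 1) ^ k i * of_nat ((i - 1) choose k i))
        * binomial_det n (\<lambda>i. x i - of_nat (k i)))
     = (\<Sum>k\<in>PiE_dflt {1..n} 0 (\<lambda>i. {..i - 1}). square_det n (\<lambda>i. a i (k i)))"
    by (intro sum.cong refl weighted)
  also have "\<dots> = square_det n (\<lambda>i j. \<Sum>k\<le>i - 1. a i k j)"
    by (rule square_det_sum_rows[symmetric]) simp
  also have "\<dots> = square_det n
      (\<lambda>i j. (backward_difference ^^ (i - 1)) (\<lambda>x. x gchoose (j - 1)) (x i))"
    by (simp add: a_def funpow_backward_difference mult_ac)
  also have "\<dots> = square_det n
      (\<lambda>i j. if j - 1 < i - 1 then 0 else (x i - of_nat (i - 1)) gchoose (j - 1 - (i - 1)))"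
    unfolding funpow_backward_difference_gbinomial ..
  also have "\<dots> = 1"
    by (subst square_det_upper_triangular) auto
  finally show ?thesis .
qed

section \<open>The Weyl dimension formula\<close>

definition weyl_dimension :: "(nat \<Rightarrow> nat) \<Rightarrow> nat \<Rightarrow> real" where
  "weyl_dimension lam n
     = (\<Prod>(i, j)\<in>{(i, j). 1 \<le> i \<and> i < j \<and> j \<le> n}. Aij lam i j / real (j - i))"

lemma weyl_dimension_eq_binomial_det:
  "weyl_dimension lam n = binomial_det n (\<lambda>i. real i - real (lam i))"
  unfolding weyl_dimension_def binomial_det_eq_prod
  by (intro prod.cong) (auto simp: Aij_def)

definition interlacing_shapes :: "(nat \<Rightarrow> nat) \<Rightarrow> nat \<Rightarrow> (nat \<Rightarrow> nat) set" where
  "interlacing_shapes lam n = PiE_dflt {1..n} 0 (\<lambda>i. {lam (Suc i)..lam i})"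

lemma finite_interlacing_shapes: "finite (interlacing_shapes lam n)"
  unfolding interlacing_shapes_def by (rule finite_PiE_dflt) auto

lemma interlacing_shapesD:
  assumes "mu \<in> interlacing_shapes lam n"
  shows "i \<in> {1..n} \<Longrightarrow> lam (Suc i) \<le> mu i" "i \<in> {1..n} \<Longrightarrow> mu i \<le> lam i"
    "i \<notin> {1..n} \<Longrightarrow> mu i = 0"
  using assms by (auto simp: interlacing_shapes_def PiE_dflt_def)

lemma antimono_on_interlacing_shape:
  assumes "antimono_on {1..Suc n} lam" "mu \<in> interlacing_shapes lam n"
  shows "antimono_on {1..n} mu"
proof (rule monotone_onI)
  fix i j assume ij: "i \<in> {1..n}" "j \<in> {1..n}" "i \<le> j"
  show "mu j \<le> mu i"
  proof (cases "i = j")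
    case False
    have "mu j \<le> lam j"
      using interlacing_shapesD(2)[OF assms(2)] ij by simp
    also have "\<dots> \<le> lam (Suc i)"
      using ij False by (intro monotone_onD[OF assms(1)]) auto
    also have "\<dots> \<le> mu i"
      using interlacing_shapesD(1)[OF assms(2)] ij by simp
    finally show ?thesis .
  qed simp
qed

lemma weyl_dimension_Suc:
  assumes "antimono_on {1..Suc n} lam"
  shows "weyl_dimension lam (Suc n) = (\<Sum>mu\<in>interlacing_shapes lam n. weyl_dimension mu n)"
proof -
  let ?x = "\<lambda>i. real i - real (lam i)"
  have row: "(\<Sum>m = lam (Suc i)..lam i. (real i - real m) gchoose (j - 1))
      = (?x (Suc i) gchoose j) - (?x i gchoose j)" if "i \<in> {1..n}" "j \<in> {1..n}" for i j
  proof -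
    have "lam (Suc i) \<le> lam i"
      using that by (intro monotone_onD[OF assms]) auto
    then show ?thesis
      using sum_gbinomial_interval[of "lam (Suc i)" "lam i" "real i" "j - 1"] that
      by (simp add: add.commute)
  qed
  have "weyl_dimension lam (Suc n)
      = square_det n (\<lambda>i j. (?x (Suc i) gchoose (Suc j - 1)) - (?x i gchoose (Suc j - 1)))"
    unfolding weyl_dimension_eq_binomial_det binomial_det_def
    by (rule square_det_Suc_row_differences) simp
  also have "\<dots> = square_det n
      (\<lambda>i j. \<Sum>m = lam (Suc i)..lam i. (real i - real m) gchoose (j - 1))"
    by (rule square_det_cong) (simp only: row diff_Suc_1)
  also have "\<dots> = (\<Sum>mu\<in>interlacing_shapes lam n. weyl_dimension mu n)"
    unfolding interlacing_shapes_def weyl_dimension_eq_binomial_det binomial_det_def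
    by (rule square_det_sum_rows) simp
  finally show ?thesis .
qed

section \<open>Branching of semistandard tableaux\<close>

lemma SST_eq_0_iff:
  assumes "T \<in> SST lam n"
  shows "T x = 0 \<longleftrightarrow> x \<notin> yd_cells lam n"
proof
  assume "T x = 0"
  moreover have "T x \<in> {1..n}" if "x \<in> yd_cells lam n"
    using assms that unfolding SST_def by blast
  ultimately show "x \<notin> yd_cells lam n" by auto
next
  show "x \<notin> yd_cells lam n \<Longrightarrow> T x = 0"
    using assms unfolding SST_def by blast
qed

lemma SST_entry_le:
  assumes "T \<in> SST lam n"
  shows "T x \<le> n"
proof (cases "x \<in> yd_cells lam n")
  case True
  then have "T x \<in> {1..n}"
    using assms unfolding SST_def by blast
  then show ?thesis by simp
next
  case False
  then show ?thesis
    using SST_eq_0_iff[OF assms, of x] by simp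
qed

lemma SST_row_le:
  assumes "T \<in> SST lam n" "(r, c) \<in> yd_cells lam n" "(r, c + 1) \<in> yd_cells lam n"
  shows "T (r, c) \<le> T (r, c + 1)"
  using assms unfolding SST_def by blast

lemma SST_column_less:
  assumes "T \<in> SST lam n" "(r, c) \<in> yd_cells lam n" "(r + 1, c) \<in> yd_cells lam n"
  shows "T (r, c) < T (r + 1, c)"
  using assms unfolding SST_def by blast

lemma SSTI:
  assumes "\<And>x. T x = 0 \<longleftrightarrow> x \<notin> yd_cells lam n" "\<And>x. T x \<le> n"
    and "\<And>r c. (r, c) \<in> yd_cells lam n \<Longrightarrow> (r, c + 1) \<in> yd_cells lam n
      \<Longrightarrow> T (r, c) \<le> T (r, c + 1)"
    and "\<And>r c. (r, c) \<in> yd_cells lam n \<Longrightarrow> (r + 1, c) \<in> yd_cells lam n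
      \<Longrightarrow> T (r, c) < T (r + 1, c)"
  shows "T \<in> SST lam n"
  using assms by (auto simp: SST_def Suc_le_eq)

lemma finite_SST: "finite (SST lam n)"
proof (rule finite_subset)
  have "yd_cells lam n = (SIGMA r:{1..n}. {1..lam r})"
    by (auto simp: yd_cells_def)
  then show "finite (PiE_dflt (yd_cells lam n) 0 (\<lambda>_. {1..n}))"
    by auto
qed (auto simp: SST_def PiE_dflt_def)

lemma SST_row_mono:
  assumes T: "T \<in> SST lam n" and "1 \<le> c" "c \<le> d" "(r, d) \<in> yd_cells lam n"
  shows "T (r, c) \<le> T (r, d)"
  using assms(3,4)
proof (induction d rule: dec_induct)
  case base
  show ?case ..
next
  case (step d)
  then have cell: "(r, d) \<in> yd_cells lam n"
    using \<open>1 \<le> c\<close> by (auto simp: yd_cells_def)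
  then have "T (r, c) \<le> T (r, d)" by (rule step.IH)
  also have "\<dots> \<le> T (r, Suc d)"
    using SST_row_le[OF T cell] step.prems by simp
  finally show ?case .
qed

lemma SST_entry_ge_row:
  assumes T: "T \<in> SST lam n" and "antimono_on {1..n} lam" and "(r, c) \<in> yd_cells lam n"
  shows "r \<le> T (r, c)"
  using assms(3)
proof (induction r)
  case 0
  show ?case by simp
next
  case (Suc r)
  show ?case
  proof (cases "r = 0")
    case True
    then show ?thesis
      using SST_eq_0_iff[OF T, of "(Suc r, c)"] Suc.prems by simp
  next
    case False
    then have "lam (Suc r) \<le> lam r"
      using Suc.prems by (intro monotone_onD[OF assms(2)]) (auto simp: yd_cells_def)
    then have cell: "(r, c) \<in> yd_cells lam n"
      using Suc.prems False by (auto simp: yd_cells_def)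
    then show ?thesis
      using Suc.IH SST_column_less[OF T cell] Suc.prems by fastforce
  qed
qed

definition row_lengths :: "(nat \<times> nat \<Rightarrow> nat) \<Rightarrow> nat \<Rightarrow> nat" where
  "row_lengths T r = card {c. T (r, c) \<noteq> 0}"

lemma row_lengths_SST:
  assumes "T \<in> SST lam n"
  shows "row_lengths T r = (if r \<in> {1..n} then lam r else 0)"
proof -
  have "{c. T (r, c) \<noteq> 0} = (if r \<in> {1..n} then {1..lam r} else {})"
    using SST_eq_0_iff[OF assms] by (auto simp: yd_cells_def)
  then show ?thesis
    by (simp add: row_lengths_def)
qed

definition restrict_entries :: "nat \<Rightarrow> (nat \<times> nat \<Rightarrow> nat) \<Rightarrow> nat \<times> nat \<Rightarrow> nat" where
  "restrict_entries n T = (\<lambda>x. if T x \<le> n then T x else 0)"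

lemma restrict_entries_nonzero: "restrict_entries n T x \<noteq> 0 \<Longrightarrow> restrict_entries n T x = T x"
  by (simp add: restrict_entries_def split: if_splits)

definition extend_tableau :: "(nat \<Rightarrow> nat) \<Rightarrow> nat \<Rightarrow> (nat \<times> nat \<Rightarrow> nat) \<Rightarrow> nat \<times> nat \<Rightarrow> nat" where
  "extend_tableau lam n T = (\<lambda>x. if T x = 0 \<and> x \<in> yd_cells lam (Suc n) then Suc n else T x)"

lemma restrict_extend_tableau:
  assumes "T \<in> SST mu n"
  shows "restrict_entries n (extend_tableau lam n T) = T"
  using SST_entry_le[OF assms] by (auto simp: restrict_entries_def extend_tableau_def)

lemma extend_restrict_tableau:
  assumes "T \<in> SST lam (Suc n)"
  shows "extend_tableau lam n (restrict_entries n T) = T"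
proof
  fix x
  show "extend_tableau lam n (restrict_entries n T) x = T x"
    using SST_entry_le[OF assms, of x] SST_eq_0_iff[OF assms, of x]
    by (auto simp: extend_tableau_def restrict_entries_def)
qed

lemma downclosed_eq_atLeastAtMost_card:
  fixes A :: "nat set"
  assumes "finite A" "0 \<notin> A" and downclosed: "\<And>a b. b \<in> A \<Longrightarrow> 1 \<le> a \<Longrightarrow> a \<le> b \<Longrightarrow> a \<in> A"
  shows "A = {1..card A}"
proof (cases "A = {}")
  case False
  have "A = {1..Max A}"
  proof (intro equalityI subsetI)
    fix a assume "a \<in> A"
    moreover from this have "a \<noteq> 0"
      using \<open>0 \<notin> A\<close> by metis
    ultimately show "a \<in> {1..Max A}"
      using \<open>finite A\<close> by simp
  next
    fix a assume "a \<in> {1..Max A}"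
    then show "a \<in> A"
      using downclosed[OF Max_in[OF \<open>finite A\<close> False]] by simp
  qed
  then obtain m where "A = {1..m}" ..
  then show ?thesis by simp
qed simp

lemma restrict_entries_eq_0_iff:
  assumes "T \<in> SST lam m"
  shows "restrict_entries n T (r, c) = 0 \<longleftrightarrow> c \<notin> {1..row_lengths (restrict_entries n T) r}"
proof -
  let ?A = "{c. restrict_entries n T (r, c) \<noteq> 0}"
  have entry_iff: "c \<in> ?A \<longleftrightarrow> (r, c) \<in> yd_cells lam m \<and> T (r, c) \<le> n" for c
    using SST_eq_0_iff[OF assms, of "(r, c)"] by (auto simp: restrict_entries_def)
  have "?A = {1..card ?A}"
  proof (rule downclosed_eq_atLeastAtMost_card)
    show "finite ?A"
    proof (rule finite_subset)
      show "?A \<subseteq> {..lam r}"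
        using entry_iff by (auto simp only: yd_cells_def)
    qed simp
    show "0 \<notin> ?A"
      unfolding entry_iff by (simp add: yd_cells_def)
    show "a \<in> ?A" if "b \<in> ?A" "1 \<le> a" "a \<le> b" for a b
      using that SST_row_mono[OF assms, of a b r] unfolding entry_iff by (auto simp: yd_cells_def)
  qed
  then show ?thesis
    unfolding row_lengths_def by blast
qed

lemma row_lengths_restrict_entries_le:
  assumes T: "T \<in> SST lam m" and "r \<in> {1..m}"
  shows "row_lengths (restrict_entries n T) r \<le> lam r"
proof (cases "row_lengths (restrict_entries n T) r = 0")
  case False
  let ?c = "row_lengths (restrict_entries n T) r"
  have "restrict_entries n T (r, ?c) \<noteq> 0"
    using False by (simp add: restrict_entries_eq_0_iff[OF T])
  then have "T (r, ?c) \<noteq> 0"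
    using restrict_entries_nonzero by metis
  then show ?thesis
    by (auto simp: SST_eq_0_iff[OF T] yd_cells_def)
qed simp

lemma row_lengths_restrict_entries_ge:
  assumes T: "T \<in> SST lam (Suc n)" and "antimono_on {1..Suc n} lam" and r: "r \<in> {1..n}"
  shows "lam (Suc r) \<le> row_lengths (restrict_entries n T) r"
proof (cases "lam (Suc r) = 0")
  case False
  let ?c = "lam (Suc r)"
  have "?c \<le> lam r"
    using r by (intro monotone_onD[OF assms(2)]) auto
  then have cells: "(r, ?c) \<in> yd_cells lam (Suc n)" "(r + 1, ?c) \<in> yd_cells lam (Suc n)"
    using False r by (auto simp: yd_cells_def)
  have "T (r, ?c) \<le> n"
    using SST_column_less[OF T cells] SST_entry_le[OF T, of "(r + 1, ?c)"] by simp
  moreover have "T (r, ?c) \<noteq> 0"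
    using SST_eq_0_iff[OF T] cells(1) by simp
  ultimately have "restrict_entries n T (r, ?c) \<noteq> 0"
    by (simp add: restrict_entries_def)
  then show ?thesis
    by (simp add: restrict_entries_eq_0_iff[OF T])
qed simp

lemma row_lengths_restrict_entries_interlacing:
  assumes T: "T \<in> SST lam (Suc n)" and "antimono_on {1..Suc n} lam"
  shows "row_lengths (restrict_entries n T) \<in> interlacing_shapes lam n"
proof -
  have "row_lengths (restrict_entries n T) r = 0" if "r \<notin> {1..n}" for r
  proof -
    have "restrict_entries n T (r, c) = 0" for c
    proof (cases "(r, c) \<in> yd_cells lam (Suc n)")
      case True
      then have "r = Suc n"
        using that by (auto simp: yd_cells_def)
      then show ?thesis
        using SST_entry_ge_row[OF assms True] by (simp add: restrict_entries_def)
    next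
      case False
      then show ?thesis
        using SST_eq_0_iff[OF T] by (simp add: restrict_entries_def)
    qed
    then show ?thesis
      by (simp add: row_lengths_def)
  qed
  then show ?thesis
    using row_lengths_restrict_entries_le[OF T] row_lengths_restrict_entries_ge[OF assms]
    by (auto simp: interlacing_shapes_def PiE_dflt_def)
qed

lemma restrict_entries_in_SST:
  assumes T: "T \<in> SST lam (Suc n)" and "antimono_on {1..Suc n} lam"
  shows "restrict_entries n T \<in> SST (row_lengths (restrict_entries n T)) n"
proof -
  let ?S = "restrict_entries n T" and ?mu = "row_lengths (restrict_entries n T)"
  have outside: "?mu r = 0" if "r \<notin> {1..n}" for r
    using interlacing_shapesD(3)[OF row_lengths_restrict_entries_interlacing[OF assms] that] .
  have S_eq_0_iff: "?S x = 0 \<longleftrightarrow> x \<notin> yd_cells ?mu n" for x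
  proof -
    obtain r c where "x = (r, c)" by (cases x)
    then show ?thesis
      using restrict_entries_eq_0_iff[OF T, of n r c] outside[of r] by (auto simp: yd_cells_def)
  qed
  have cell: "?S x = T x \<and> x \<in> yd_cells lam (Suc n)" if "x \<in> yd_cells ?mu n" for x
    using S_eq_0_iff[of x] restrict_entries_nonzero[of n T x] SST_eq_0_iff[OF T, of x] that by auto
  show ?thesis
  proof (rule SSTI)
    show "?S x \<le> n" for x
      by (simp add: restrict_entries_def)
    show "?S (r, c) \<le> ?S (r, c + 1)"
      if "(r, c) \<in> yd_cells ?mu n" "(r, c + 1) \<in> yd_cells ?mu n" for r c
      using SST_row_le[OF T] cell that by simp
    show "?S (r, c) < ?S (r + 1, c)"
      if "(r, c) \<in> yd_cells ?mu n" "(r + 1, c) \<in> yd_cells ?mu n" for r c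
      using SST_column_less[OF T] cell that by simp
  qed (rule S_eq_0_iff)
qed

lemma yd_cells_interlacing_subset:
  assumes "mu \<in> interlacing_shapes lam n"
  shows "yd_cells mu n \<subseteq> yd_cells lam (Suc n)"
  using interlacing_shapesD(2)[OF assms] by (force simp: yd_cells_def)

lemma interlacing_horizontal_strip:
  assumes "mu \<in> interlacing_shapes lam n"
    and "(r, c) \<in> yd_cells lam (Suc n)" "(r + 1, c) \<in> yd_cells lam (Suc n)"
  shows "(r, c) \<in> yd_cells mu n"
proof -
  have "r \<in> {1..n}"
    using assms(2,3) by (auto simp: yd_cells_def)
  then show ?thesis
    using assms(2,3) interlacing_shapesD(1)[OF assms(1), of r] by (auto simp: yd_cells_def)
qed

lemma extend_tableau_in_SST:
  assumes mu: "mu \<in> interlacing_shapes lam n" and T: "T \<in> SST mu n"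
  shows "extend_tableau lam n T \<in> SST lam (Suc n)"
proof (rule SSTI)
  let ?E = "extend_tableau lam n T"
  note T_eq_0_iff = SST_eq_0_iff[OF T]
  have E_inner: "?E x = T x" if "x \<in> yd_cells mu n" for x
    using that T_eq_0_iff[of x] by (simp add: extend_tableau_def)
  have E_outer: "?E x = Suc n" if "x \<in> yd_cells lam (Suc n)" "x \<notin> yd_cells mu n" for x
    using that T_eq_0_iff[of x] by (simp add: extend_tableau_def)
  show "?E x = 0 \<longleftrightarrow> x \<notin> yd_cells lam (Suc n)" for x
    using T_eq_0_iff[of x] yd_cells_interlacing_subset[OF mu] by (auto simp: extend_tableau_def)
  show E_le: "?E x \<le> Suc n" for x
    using SST_entry_le[OF T, of x] by (simp add: extend_tableau_def)
  fix r c assume cell: "(r, c) \<in> yd_cells lam (Suc n)"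
  show "?E (r, c) \<le> ?E (r, c + 1)" if right: "(r, c + 1) \<in> yd_cells lam (Suc n)"
  proof (cases "(r, c + 1) \<in> yd_cells mu n")
    case True
    moreover from this have "(r, c) \<in> yd_cells mu n"
      using cell by (auto simp: yd_cells_def)
    ultimately show ?thesis
      using SST_row_le[OF T] by (simp add: E_inner)
  next
    case False
    then show ?thesis
      using E_le E_outer[OF right] by simp
  qed
  show "?E (r, c) < ?E (r + 1, c)" if below: "(r + 1, c) \<in> yd_cells lam (Suc n)"
  proof -
    have inner: "(r, c) \<in> yd_cells mu n"
      using interlacing_horizontal_strip[OF mu cell below] .
    then show ?thesis
      using SST_column_less[OF T inner] SST_entry_le[OF T, of "(r, c)"] below
      by (cases "(r + 1, c) \<in> yd_cells mu n") (simp_all add: E_inner E_outer)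
  qed
qed

lemma bij_betw_extend_tableau:
  assumes "antimono_on {1..Suc n} lam"
  shows "bij_betw (extend_tableau lam n)
    (\<Union>mu\<in>interlacing_shapes lam n. SST mu n) (SST lam (Suc n))"
proof (rule bij_betw_byWitness[where f' = "restrict_entries n"])
  show "\<forall>T\<in>\<Union>mu\<in>interlacing_shapes lam n. SST mu n.
      restrict_entries n (extend_tableau lam n T) = T"
    using restrict_extend_tableau by blast
  show "\<forall>T\<in>SST lam (Suc n). extend_tableau lam n (restrict_entries n T) = T"
    using extend_restrict_tableau by blast
  show "extend_tableau lam n ` (\<Union>mu\<in>interlacing_shapes lam n. SST mu n) \<subseteq> SST lam (Suc n)"
    using extend_tableau_in_SST by blast
  show "restrict_entries n ` SST lam (Suc n) \<subseteq> (\<Union>mu\<in>interlacing_shapes lam n. SST mu n)"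
    using restrict_entries_in_SST row_lengths_restrict_entries_interlacing assms by blast
qed

lemma card_SST_Suc:
  assumes "antimono_on {1..Suc n} lam"
  shows "card (SST lam (Suc n)) = (\<Sum>mu\<in>interlacing_shapes lam n. card (SST mu n))"
proof -
  have disjoint: "SST mu n \<inter> SST nu n = {}"
    if "mu \<in> interlacing_shapes lam n" "nu \<in> interlacing_shapes lam n" "mu \<noteq> nu" for mu nu
  proof (rule ccontr)
    assume "SST mu n \<inter> SST nu n \<noteq> {}"
    then obtain T where T: "T \<in> SST mu n" "T \<in> SST nu n" by blast
    have "mu r = nu r" for r
      using row_lengths_SST[OF T(1), of r] row_lengths_SST[OF T(2), of r]
        interlacing_shapesD(3)[OF that(1), of r] interlacing_shapesD(3)[OF that(2), of r]
      by (simp split: if_splits)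
    with \<open>mu \<noteq> nu\<close> show False by blast
  qed
  have "card (SST lam (Suc n)) = card (\<Union>mu\<in>interlacing_shapes lam n. SST mu n)"
    using bij_betw_same_card[OF bij_betw_extend_tableau[OF assms]] by simp
  also have "\<dots> = (\<Sum>mu\<in>interlacing_shapes lam n. card (SST mu n))"
    using finite_interlacing_shapes finite_SST disjoint by (intro card_UN_disjoint) auto
  finally show ?thesis .
qed

theorem card_SST:
  assumes "antimono_on {1..n} lam"
  shows "real (card (SST lam n)) = weyl_dimension lam n"
  using assms
proof (induction n arbitrary: lam)
  case 0
  have "SST lam 0 = {\<lambda>_. 0}"
    by (auto simp: SST_def yd_cells_def)
  then show ?case
    by (simp add: weyl_dimension_eq_binomial_det binomial_det_def)
next
  case (Suc n)
  have "real (card (SST lam (Suc n))) = (\<Sum>mu\<in>interlacing_shapes lam n. weyl_dimension mu n)"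
    using Suc.IH antimono_on_interlacing_shape[OF Suc.prems]
    by (simp add: card_SST_Suc[OF Suc.prems])
  then show ?case
    by (simp add: weyl_dimension_Suc[OF Suc.prems])
qed

section \<open>Holman's series\<close>

lemma pochhammer_minus_nat_ratio:
  "pochhammer (- of_nat m) k / pochhammer 1 k = (- 1) ^ k * (of_nat (m choose k) :: 'a :: field_char_0)"
  by (simp add: binomial_gbinomial gbinomial_pochhammer flip: pochhammer_fact mult.assoc power_add)

lemma holman_term_eq_weyl_dimension:
  "holman_term lam n k
     = (\<Prod>i = 1..n. (- 1) ^ k i * real ((i - 1) choose k i))
         * weyl_dimension (\<lambda>i. lam i + k i) n / weyl_dimension lam n"
proof -
  let ?P = "{(i, j). 1 \<le> i \<and> i < j \<and> j \<le> n}"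
  have shift: "Aij (\<lambda>i. lam i + k i) i j = Aij lam i j + real (k i) - real (k j)" for i j
    by (simp add: Aij_def)
  have ratio: "(\<Prod>(i, j)\<in>?P. (Aij lam i j + real (k i) - real (k j)) / Aij lam i j)
      = weyl_dimension (\<lambda>i. lam i + k i) n / weyl_dimension lam n"
    unfolding weyl_dimension_def prod_dividef[symmetric]
    by (intro prod.cong refl) (auto simp: shift simp del: of_nat_diff)
  show ?thesis
    unfolding holman_term_def pochhammer_minus_nat_ratio ratio by simp
qed

lemma sum_holman_term:
  "(\<Sum>k\<in>PiE_dflt {1..n} 0 (\<lambda>i. {..i - 1}). holman_term lam n k) = 1 / weyl_dimension lam n"
  using sum_alternating_binomial_det[of n "\<lambda>i. real i - real (lam i)"]
  unfolding holman_term_eq_weyl_dimension weyl_dimension_eq_binomial_det[of "\<lambda>i. lam i + _ i"]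
  by (simp add: diff_diff_eq flip: sum_divide_distrib)

lemma holman_term_has_sum:
  "(holman_term lam n has_sum 1 / weyl_dimension lam n) {k. \<forall>i. i \<notin> {1..n} \<longrightarrow> k i = 0}"
proof (rule has_sum_finite_neutralI[where B = "PiE_dflt {1..n} 0 (\<lambda>i. {..i - 1})"])
  show "finite (PiE_dflt {1..n} (0 :: nat) (\<lambda>i. {..i - 1}))"
    by auto
  show "PiE_dflt {1..n} 0 (\<lambda>i. {..i - 1}) \<subseteq> {k. \<forall>i. i \<notin> {1..n} \<longrightarrow> k i = 0}"
    by (auto simp: PiE_dflt_def)
  show "1 / weyl_dimension lam n = (\<Sum>k\<in>PiE_dflt {1..n} 0 (\<lambda>i. {..i - 1}). holman_term lam n k)"
    by (rule sum_holman_term[symmetric])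
  fix k assume "k \<in> {k. \<forall>i. i \<notin> {1..n} \<longrightarrow> k i = 0} - PiE_dflt {1..n} 0 (\<lambda>i. {..i - 1})"
  then obtain i where i: "i \<in> {1..n}" "i - 1 < k i"
    by (auto simp: PiE_dflt_def not_le)
  then have "(\<Prod>i = 1..n. (- 1) ^ k i * real ((i - 1) choose k i)) = 0"
    by (intro prod_zero) (auto intro!: bexI[of _ i] simp: binomial_eq_0)
  then show "holman_term lam n k = 0"
    by (simp add: holman_term_eq_weyl_dimension)
qed

theorem theorem3p9:
  fixes n :: nat and lam :: "nat \<Rightarrow> nat"
  assumes "n \<ge> 1"
    and "\<forall>i j. 1 \<le> i \<and> i \<le> j \<and> j \<le> n \<longrightarrow> lam j \<le> lam i"
  shows "(holman_term lam n has_sum (1 / real (card (SST lam n))))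
           {k :: nat \<Rightarrow> nat. \<forall>i. i \<notin> {1..n} \<longrightarrow> k i = 0}
       \<and> 1 / real (card (SST lam n)) =
           (\<Prod>(i, j)\<in>{(i, j). 1 \<le> i \<and> i < j \<and> j \<le> n}.
              real (j - i) / Aij lam i j)"
proof -
  have "antimono_on {1..n} lam"
    using assms(2) by (auto intro!: monotone_onI)
  then have card_eq: "real (card (SST lam n)) = weyl_dimension lam n"
    by (rule card_SST)
  have "1 / weyl_dimension lam n
      = (\<Prod>(i, j)\<in>{(i, j). 1 \<le> i \<and> i < j \<and> j \<le> n}. real (j - i) / Aij lam i j)"
    unfolding weyl_dimension_def inverse_eq_divide[symmetric] prod_inversef[symmetric]
    by (intro prod.cong) auto
  with holman_term_has_sum show ?thesis
    unfolding card_eq by blast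
qed

end
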